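(* Let $f:\mathbb{F}_2^n\to\mathbb{F}_2^n$ be a Boolean monomial system with dependency graph $\mathcal{X}$. The following are equivalent: (1) $f$ is a fixed point system. (2) For every vertex $a\in\mathcal{X}$ one of the following holds: (a) $a$ allows two closed walks $p,q:a\to a$ of length $|q|=|p|+1$; (b) $a$ is connected with a walk to a zero (i.e. there is a walk from $a$ to a zero); (c) there is no walk of length $\ge 1$ from $a$ to $a$.
   Context: A Boolean monomial system is a map $f=(f_1,\ldots,f_n):\mathbb{F}_2^n\to\mathbb{F}_2^n$ (updated in parallel) where each $f_i=\alpha_i x_1^{\varepsilon_{1i}}\cdots x_n^{\varepsilon_{ni}}$ with $\alpha_i,\varepsilon_{ji}\in\{0,1\}$ (all $\varepsilon_{ji}=0$ if $\alpha_i=0$); so each $f_i$ is $0$, $1$, or a product of distinct variables. $f$ is a fixed point system if all limit cycles (directed cycles of the digraph $u\to f(u)$ on $\mathbb{F}_2^n$) are fixed points. The dependency graph $\mathcal{X}$ of $f$ is the digraph with vertex set $\{a_1,\ldots,a_n,\varepsilon\}$, with an edge $a_i\to a_j$ iff $\alpha_i=1$ and $\varepsilon_{ji}=1$ (i.e. $x_j$ divides $f_i$), and an edge $a_i\to\varepsilon$ iff $f_i=0$. Write $a\in\mathcal{X}$ for a vertex $a\ne\varepsilon$. A vertex $a$ with an edge $a\to\varepsilon$ is called a zero. A walk is a directed walk (repetitions allowed), $|p|$ is its length, and every vertex has an empty walk of length $0$ to itself. *)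

theory Defs
  imports
    "HOL-Analysis.Finite_Cartesian_Product"
    "HOL-Library.Z2"
    "Graph_Theory.Pair_Digraph"
begin

text \<open>The field \<open>F\<^sub>2\<close> is the type \<^typ>\<open>bit\<close>; coordinates are indexed by a finite type
  of \<open>n\<close> elements. As in the source, \<open>\<epsilon> j i\<close> is the exponent of \<open>x\<^sub>j\<close> in \<open>f\<^sub>i\<close>.\<close>

definition monomial :: "('n::finite \<Rightarrow> bit) \<Rightarrow> ('n \<Rightarrow> 'n \<Rightarrow> nat) \<Rightarrow> 'n \<Rightarrow> bit ^ 'n \<Rightarrow> bit" where
  "monomial \<alpha> \<epsilon> i = (\<lambda>x. \<alpha> i * (\<Prod>j\<in>UNIV. (x $ j) ^ \<epsilon> j i))"

text \<open>The normalisation of the exponents (zero wherever \<open>\<alpha>\<^sub>i = 0\<close>) makes \<open>\<alpha>\<close> and \<open>\<epsilon>\<close>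
  unique for a given \<open>f\<close>, so that the graph below depends on \<open>f\<close> only.\<close>

definition boolean_monomial_system ::
  "('n::finite \<Rightarrow> bit) \<Rightarrow> ('n \<Rightarrow> 'n \<Rightarrow> nat) \<Rightarrow> (bit ^ 'n \<Rightarrow> bit ^ 'n) \<Rightarrow> bool" where
  "boolean_monomial_system \<alpha> \<epsilon> f \<longleftrightarrow>
     (\<forall>i j. \<epsilon> j i \<in> {0, 1}) \<and>
     (\<forall>i. \<alpha> i = 0 \<longrightarrow> (\<forall>j. \<epsilon> j i = 0)) \<and>
     (\<forall>x i. f x $ i = monomial \<alpha> \<epsilon> i x)"

definition state_graph :: "('s \<Rightarrow> 's) \<Rightarrow> 's pair_pre_digraph" where
  "state_graph f = \<lparr> pverts = UNIV, parcs = {(u, f u) | u. True} \<rparr>"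

text \<open>Walks and cycles are lists of arcs, and cycles may be loops. A limit cycle is
  a fixed point when it is the loop at a fixed point.\<close>

definition limit_cycle :: "('s \<Rightarrow> 's) \<Rightarrow> ('s \<times> 's) awalk \<Rightarrow> bool" where
  "limit_cycle f p \<longleftrightarrow> pre_digraph.cycle (with_proj (state_graph f)) p"

definition fixed_point_system :: "('s \<Rightarrow> 's) \<Rightarrow> bool" where
  "fixed_point_system f \<longleftrightarrow> (\<forall>p. limit_cycle f p \<longrightarrow> (\<exists>u. f u = u \<and> p = [(u, u)]))"

datatype 'n dep_vertex = Vertex 'n | Epsilon

definition dependency_graph ::
  "('n::finite \<Rightarrow> bit) \<Rightarrow> ('n \<Rightarrow> 'n \<Rightarrow> nat) \<Rightarrow> 'n dep_vertex pair_pre_digraph" where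
  "dependency_graph \<alpha> \<epsilon> =
     \<lparr> pverts = range Vertex \<union> {Epsilon},
       parcs = {(Vertex i, Vertex j) | i j. \<alpha> i = 1 \<and> \<epsilon> j i = 1} \<union>
               {(Vertex i, Epsilon) | i. monomial \<alpha> \<epsilon> i = (\<lambda>x. 0)} \<rparr>"

text \<open>The empty list is a walk from every vertex to itself.\<close>

definition walk :: "'v pair_pre_digraph \<Rightarrow> 'v \<Rightarrow> ('v \<times> 'v) awalk \<Rightarrow> 'v \<Rightarrow> bool" where
  "walk X u p v \<longleftrightarrow> pre_digraph.awalk (with_proj X) u p v"

definition is_zero :: "'n dep_vertex pair_pre_digraph \<Rightarrow> 'n dep_vertex \<Rightarrow> bool" where
  "is_zero X a \<longleftrightarrow> (a, Epsilon) \<in> parcs X"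

end

theory Submission
  imports Defs
begin

text \<open>
  Unfolding the iterates, coordinate \<open>i\<close> of \<open>f\<^sup>m(x)\<close> is \<open>0\<close> iff \<open>i\<close> reaches a zero in fewer
  than \<open>m\<close> steps or has a walk of length \<open>m\<close> to some \<open>j\<close> with \<open>x\<^sub>j = 0\<close>.

  If \<open>a\<close> violates all three alternatives, start at the state whose only \<open>0\<close> is at \<open>a\<close>: coordinate
  \<open>a\<close> is then \<open>0\<close> exactly at the lengths of closed walks at \<open>a\<close>, so it is \<open>0\<close> at all multiples of
  some \<open>l \<ge> 1\<close> but \<open>1\<close> one step later, and the trajectory never becomes stationary.

  Conversely let \<open>f\<^sup>m(u) = u\<close> and \<open>u\<^sub>a = 0\<close>, where \<open>a\<close> reaches no zero. Walking backwards through the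
  period leads from \<open>a\<close>, in a multiple of \<open>m\<close> steps, to some \<open>c\<close> with \<open>u\<^sub>c = 0\<close> that lies on a
  closed walk. Closed walks of lengths \<open>p\<close> and \<open>p + 1\<close> at \<open>c\<close> combine to one of length
  \<open>(m - 1)p + (p + 1) = mp + 1\<close>, whence \<open>f(u)\<^sub>a = 0\<close>. So \<open>f\<close> is decreasing on periodic states, and
  these must be fixed.
\<close>

section \<open>Walks of given length as powers of the arc relation\<close>

lemma relpow_Suc_iff: "(u, v) \<in> R ^^ Suc k \<longleftrightarrow> (\<exists>w. (u, w) \<in> R \<and> (w, v) \<in> R ^^ k)"
  by (metis relpow_Suc_D2 relpow_Suc_I2)

lemma funpow_repeats:
  assumes "finite A" "\<And>k. (f ^^ k) x \<in> A"
  obtains s t where "s < t" "(f ^^ s) x = (f ^^ t) x"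
proof -
  have "finite (range (\<lambda>k. (f ^^ k) x))"
    by (rule finite_subset[OF _ assms(1)]) (use assms(2) in auto)
  then have "\<not> inj (\<lambda>k. (f ^^ k) x)" using range_inj_infinite by blast
  then obtain s t where "s \<noteq> t" "(f ^^ s) x = (f ^^ t) x" unfolding inj_def by blast
  then show thesis using that by (metis nat_neq_iff)
qed

text \<open>Only the lengths of walks matter below, and relation powers record exactly these. For
  \<open>k = 0\<close> the power relates \<open>u\<close> to itself even outside the graph, hence
  the condition on \<open>pverts X\<close>.\<close>

lemma ex_walk_iff_relpow:
  "(\<exists>p. walk X u p v \<and> length p = k) \<longleftrightarrow> u \<in> pverts X \<and> (u, v) \<in> parcs X ^^ k"
proof -
  have "(\<exists>p. set p \<subseteq> parcs X \<and> pcas u p v \<and> length p = k) \<longleftrightarrow> (u, v) \<in> parcs X ^^ k"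
  proof (induction k arbitrary: u)
    case 0
    show ?case by auto
  next
    case (Suc k)
    have "(\<exists>p. set p \<subseteq> parcs X \<and> pcas u p v \<and> length p = Suc k) \<longleftrightarrow>
        (\<exists>w. (u, w) \<in> parcs X \<and> (\<exists>p. set p \<subseteq> parcs X \<and> pcas w p v \<and> length p = k))"
      (is "?L \<longleftrightarrow> ?R")
    proof
      assume ?L
      then obtain p where p: "set p \<subseteq> parcs X" "pcas u p v" "length p = Suc k" by blast
      then obtain e q where "p = e # q" by (cases p) auto
      with p show ?R by (cases e) auto
    next
      assume ?R
      then obtain w p where "(u, w) \<in> parcs X" "set p \<subseteq> parcs X" "pcas w p v" "length p = k"
        by blast
      then show ?L by (intro exI[of _ "(u, w) # p"]) auto
    qed
    then show ?case
      unfolding Suc.IH relpow_Suc_iff .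
  qed
  then show ?thesis
    by (auto simp: walk_def pre_digraph.awalk_def cas_with_proj_eq)
qed

section \<open>Limit cycles and periodic states\<close>

lemma pcas_state_graph:
  assumes "set p \<subseteq> parcs (state_graph f)" "pcas u p v"
  shows "(f ^^ length p) u = v"
  using assms
  by (induction p arbitrary: u) (auto simp: state_graph_def funpow_Suc_right simp del: funpow.simps)

text \<open>\<open>tl\<close> drops the starting vertex, which a closed walk repeats at its
  end.\<close>

lemma limit_cycle_iff:
  "limit_cycle f p \<longleftrightarrow> (\<exists>u. set p \<subseteq> parcs (state_graph f) \<and> pcas u p u \<and>
     distinct (tl (pawalk_verts u p)) \<and> p \<noteq> [])"
  by (auto simp: limit_cycle_def pre_digraph.cycle_def pre_digraph.awalk_def
      cas_with_proj_eq awalk_verts_with_proj_eq state_graph_def)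

definition orbit_walk :: "('s \<Rightarrow> 's) \<Rightarrow> 's \<Rightarrow> nat \<Rightarrow> ('s \<times> 's) list" where
  "orbit_walk f u m = map (\<lambda>k. ((f ^^ k) u, (f ^^ Suc k) u)) [0..<m]"

lemma orbit_walk_Suc:
  "orbit_walk f u (Suc m) = (u, f u) # orbit_walk f (f u) m"
proof -
  have "[0..<Suc m] = 0 # map Suc [0..<m]" by (simp add: map_Suc_upt upt_conv_Cons)
  then show ?thesis
    by (simp add: orbit_walk_def o_def funpow_Suc_right funpow_swap1 del: upt_Suc)
qed

lemma pcas_orbit_walk: "pcas u (orbit_walk f u m) ((f ^^ m) u)"
proof (induction m arbitrary: u)
  case 0
  show ?case by (simp add: orbit_walk_def)
next
  case (Suc m)
  from Suc[of "f u"] show ?case by (simp add: orbit_walk_Suc funpow_swap1)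
qed

lemma pawalk_verts_orbit_walk:
  "pawalk_verts u (orbit_walk f u m) = u # map snd (orbit_walk f u m)"
proof (induction m arbitrary: u)
  case 0
  show ?case by (simp add: orbit_walk_def)
next
  case (Suc m)
  from Suc[of "f u"] show ?case by (simp add: orbit_walk_Suc)
qed

lemma fixed_point_system_iff:
  "fixed_point_system f \<longleftrightarrow> (\<forall>u m. m \<ge> 1 \<longrightarrow> (f ^^ m) u = u \<longrightarrow> f u = u)"
proof
  assume fps: "fixed_point_system f"
  show "\<forall>u m. m \<ge> 1 \<longrightarrow> (f ^^ m) u = u \<longrightarrow> f u = u"
  proof (intro allI impI)
    fix u and m :: nat
    assume m: "m \<ge> 1" "(f ^^ m) u = u"
    \<comment> \<open>An arbitrary period \<open>m\<close> may run round the cycle several times;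
      only the least one visits distinct states, as a cycle must.\<close>
    define n where "n = (LEAST n. n \<ge> 1 \<and> (f ^^ n) u = u)"
    have n: "n \<ge> 1" "(f ^^ n) u = u"
      unfolding n_def using LeastI[of "\<lambda>n. n \<ge> 1 \<and> (f ^^ n) u = u", OF conjI[OF m]] by auto
    have least: "n \<le> k" if "k \<ge> 1" "(f ^^ k) u = u" for k
      unfolding n_def using that by (intro Least_le) auto
    have ne: "(f ^^ Suc i) u \<noteq> (f ^^ Suc j) u" if "i < j" "j < n" for i j
    proof
      assume eq: "(f ^^ Suc i) u = (f ^^ Suc j) u"
      \<comment> \<open>Advancing both sides by \<open>n - Suc j\<close> takes the right one to time
        \<open>n\<close>, so the left one is back at \<open>u\<close> after fewer than
        \<open>n\<close> steps.\<close>
      have "(f ^^ (n - Suc j + Suc i)) u = (f ^^ (n - Suc j + Suc j)) u"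
        by (simp only: funpow_add o_apply eq)
      then have "(f ^^ (n - Suc j + Suc i)) u = u" using that n by simp
      from least[OF _ this] that show False by simp
    qed
    have "inj_on (\<lambda>k. (f ^^ Suc k) u) {..<n}"
      by (rule linorder_inj_onI) (use ne in auto)
    then have dist: "distinct (map snd (orbit_walk f u n))"
      by (simp add: orbit_walk_def o_def distinct_map atLeast0LessThan)
    obtain k where k: "n = Suc k" using n by (cases n) auto
    have "limit_cycle f (orbit_walk f u n)"
      unfolding limit_cycle_iff
    proof (intro exI conjI)
      show "set (orbit_walk f u n) \<subseteq> parcs (state_graph f)"
        by (auto simp: orbit_walk_def state_graph_def)
      show "pcas u (orbit_walk f u n) u" using pcas_orbit_walk[of u f n] n by simp
      show "distinct (tl (pawalk_verts u (orbit_walk f u n)))" using dist by (simp add: pawalk_verts_orbit_walk)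
      show "orbit_walk f u n \<noteq> []" using k by (simp add: orbit_walk_Suc)
    qed
    with fps obtain v where "f v = v" "orbit_walk f u n = [(v, v)]"
      unfolding fixed_point_system_def by blast
    then show "f u = u" using k by (simp add: orbit_walk_Suc)
  qed
next
  assume per: "\<forall>u m. m \<ge> 1 \<longrightarrow> (f ^^ m) u = u \<longrightarrow> f u = u"
  show "fixed_point_system f"
    unfolding fixed_point_system_def
  proof (intro allI impI)
    fix p assume "limit_cycle f p"
    then obtain u where u: "set p \<subseteq> parcs (state_graph f)" "pcas u p u"
      "distinct (tl (pawalk_verts u p))" "p \<noteq> []"
      unfolding limit_cycle_iff by blast
    have fu: "f u = u"
      using per pcas_state_graph[OF u(1,2)] u(4) by (metis One_nat_def Suc_leI length_greater_0_conv)
    obtain q where q: "p = (u, u) # q"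
      using u(1,2,4) fu by (cases p) (auto simp: state_graph_def)
    \<comment> \<open>A second arc would again be the loop at \<open>u\<close> and repeat
      \<open>u\<close> in the tail of the vertex list.\<close>
    have "q = []"
    proof (cases q)
      case (Cons e r)
      then have "e = (u, u)" using u(1,2) q fu by (cases e) (auto simp: state_graph_def)
      moreover from this have "u \<in> set (pawalk_verts u r)"
        using u(2) q Cons by (cases r) auto
      ultimately show ?thesis using u(3) q Cons by simp
    qed simp
    with q fu show "\<exists>u. f u = u \<and> p = [(u, u)]" by blast
  qed
qed

section \<open>Conjunctive networks: edges \<open>R\<close> between variables, zeros
  \<open>Z\<close>\<close>

locale conjunctive_network =
  fixes f :: "bit ^ 'n::finite \<Rightarrow> bit ^ 'n"
    and R :: "'n rel"
    and Z :: "'n set"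
  assumes step: "f x $ i = 1 \<longleftrightarrow> i \<notin> Z \<and> (\<forall>j. (i, j) \<in> R \<longrightarrow> x $ j = 1)"
begin

text \<open>The bound is \<open>k < m\<close>, not \<open>k \<le> m\<close>: a zero at distance
  \<open>k\<close> acts only once \<open>f\<close> has been applied \<open>k + 1\<close> times,
  since its own initial value is arbitrary.\<close>

lemma funpow_eq_0_iff:
  "(f ^^ m) x $ i = 0 \<longleftrightarrow>
     (\<exists>k<m. \<exists>z\<in>Z. (i, z) \<in> R ^^ k) \<or> (\<exists>j. (i, j) \<in> R ^^ m \<and> x $ j = 0)"
proof (induction m arbitrary: i)
  case 0
  show ?case by auto
next
  case (Suc m)
  have "(f ^^ Suc m) x $ i = 0 \<longleftrightarrow> i \<in> Z \<or> (\<exists>j. (i, j) \<in> R \<and> (f ^^ m) x $ j = 0)"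
  proof -
    have eq_0: "b = 0 \<longleftrightarrow> b \<noteq> 1" for b :: bit by simp
    show ?thesis unfolding eq_0 funpow.simps o_apply step by blast
  qed
  also have "\<dots> \<longleftrightarrow> i \<in> Z \<or> (\<exists>k<m. \<exists>z\<in>Z. (i, z) \<in> R ^^ Suc k) \<or>
      (\<exists>j. (i, j) \<in> R ^^ Suc m \<and> x $ j = 0)"
    unfolding Suc.IH relpow_Suc_iff by blast
  also have "\<dots> \<longleftrightarrow> (\<exists>k<Suc m. \<exists>z\<in>Z. (i, z) \<in> R ^^ k) \<or>
      (\<exists>j. (i, j) \<in> R ^^ Suc m \<and> x $ j = 0)"
    unfolding Ex_less_Suc2 by auto
  finally show ?case .
qed

text \<open>Alternatives (a), (b), (c) of the theorem, in this order, with walks replaced by powers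
  of \<open>R\<close>.\<close>

definition good :: "'n \<Rightarrow> bool" where
  "good a \<longleftrightarrow> (\<exists>p. (a, a) \<in> R ^^ p \<and> (a, a) \<in> R ^^ Suc p) \<or> (\<exists>k. \<exists>z\<in>Z. (a, z) \<in> R ^^ k) \<or>
     \<not> (\<exists>k\<ge>1. (a, a) \<in> R ^^ k)"

lemma closed_walk_mult: "(a, a) \<in> R ^^ l \<Longrightarrow> (a, a) \<in> R ^^ (k * l)"
  by (induction k) (auto simp: relpow_add)

lemma good_if_periodic_fixed:
  assumes per: "\<And>u m. m \<ge> 1 \<Longrightarrow> (f ^^ m) u = u \<Longrightarrow> f u = u"
  shows "good a"
proof (rule ccontr)
  assume bad: "\<not> good a"
  then obtain l where l: "l \<ge> 1" "(a, a) \<in> R ^^ l" unfolding good_def by blast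
  define x :: "bit ^ 'n" where "x = (\<chi> j. if j = a then 0 else 1)"
  have x0: "x $ j = 0 \<longleftrightarrow> j = a" for j by (simp add: x_def)
  have osc: "(f ^^ t) x $ a = 0 \<longleftrightarrow> (a, a) \<in> R ^^ t" for t
    using bad unfolding funpow_eq_0_iff good_def by (auto simp: x0)
  \<comment> \<open>A state is determined by its set of ones, so there are finitely many states and
    the trajectory of \<open>x\<close> repeats.\<close>
  have "inj (\<lambda>v :: bit ^ 'n. {i. v $ i = 1})"
    by (rule injI) (metis (mono_tags, lifting) bit_not_one_iff mem_Collect_eq vec_eq_iff)
  then have "finite (UNIV :: (bit ^ 'n) set)"
    using finite_imageD finite by blast
  then obtain s t where st: "s < t" "(f ^^ s) x = (f ^^ t) x"
    by (rule funpow_repeats) auto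
  have "(f ^^ (t - s)) ((f ^^ s) x) = (f ^^ (t - s + s)) x"
    by (simp only: funpow_add o_apply)
  also have "\<dots> = (f ^^ s) x" using st by simp
  finally have "(f ^^ (t - s)) ((f ^^ s) x) = (f ^^ s) x" .
  then have "f ((f ^^ s) x) = (f ^^ s) x" using per[of "t - s"] st by simp
  then have const: "(f ^^ k) ((f ^^ s) x) = (f ^^ s) x" for k
    by (induction k) auto
  have stable: "(f ^^ k) x = (f ^^ s) x" if "s \<le> k" for k
    using const[of "k - s"] that by (metis comp_apply funpow_add le_add_diff_inverse2)
  \<comment> \<open>The trajectory is constant from time \<open>s\<close> on; \<open>s * l\<close>
    is a closed walk length that late.\<close>
  have "s \<le> s * l" using l by simp
  have closed: "(a, a) \<in> R ^^ (s * l)" using closed_walk_mult l by blast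
  have "(f ^^ Suc (s * l)) x = (f ^^ (s * l)) x"
    using stable[of "s * l"] stable[of "Suc (s * l)"] \<open>s \<le> s * l\<close> by simp
  then have "(a, a) \<in> R ^^ Suc (s * l)" using closed osc by metis
  with closed bad show False unfolding good_def by blast
qed

lemma periodic_decreasing:
  assumes good: "\<And>a. good a" and m: "m \<ge> 1" "(f ^^ m) u = u" and a: "u $ a = 0"
  shows "f u $ a = 0"
proof (cases "\<exists>k. \<exists>z\<in>Z. (a, z) \<in> R ^^ k")
  case True
  have per: "(f ^^ (k * m)) u = u" for k
    using m(2) by (induction k) (simp_all add: funpow_add)
  from True obtain k z where kz: "z \<in> Z" "(a, z) \<in> R ^^ k" by blast
  \<comment> \<open>A time above \<open>k\<close> lets the zero reach \<open>a\<close>; being 1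
    modulo \<open>m\<close>, it gives the state \<open>f u\<close>.\<close>
  have "k < Suc (k * m)" using m by (simp add: le_imp_less_Suc)
  then have "(f ^^ Suc (k * m)) u $ a = 0" unfolding funpow_eq_0_iff using kz by blast
  then show ?thesis using per by simp
next
  case False
  have per: "(f ^^ (k * m)) u = u" for k
    using m(2) by (induction k) (simp_all add: funpow_add)
  define A where "A = {b. u $ b = 0 \<and> (\<exists>k. (a, b) \<in> R ^^ (k * m))}"
  have noZ: "\<not> (\<exists>k. \<exists>z\<in>Z. (b, z) \<in> R ^^ k)" if "b \<in> A" for b
    proof -
    from that obtain l where "(a, b) \<in> R ^^ l" unfolding A_def by blast
    then show ?thesis using False relpow_trans by metis
  qed
  have "\<exists>c\<in>A. (b, c) \<in> R ^^ m" if b: "b \<in> A" for b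
  proof -
    from b have "(f ^^ m) u $ b = 0" using m A_def by simp
    then obtain c where c: "(b, c) \<in> R ^^ m" "u $ c = 0"
      unfolding funpow_eq_0_iff using noZ[OF b] by blast
    from b obtain k where "(a, b) \<in> R ^^ (k * m)" unfolding A_def by blast
    with c(1) have "(a, c) \<in> R ^^ (Suc k * m)" by (metis add.commute mult_Suc relpow_trans)
    with c show ?thesis unfolding A_def by blast
  qed
  \<comment> \<open>Iterating the choice \<open>g\<close> gives an infinite walk inside the finite
    set \<open>A\<close>; a repeated vertex of it is the required \<open>c\<close>.\<close>
  then obtain g where g: "\<And>b. b \<in> A \<Longrightarrow> g b \<in> A \<and> (b, g b) \<in> R ^^ m" by metis
  have "a \<in> A" unfolding A_def using a by (auto intro: exI[of _ 0])
  then have gA: "(g ^^ k) a \<in> A" for k using g by (induction k) auto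
  have walk: "((g ^^ s) a, (g ^^ (k + s)) a) \<in> R ^^ (k * m)" for s k
  proof (induction k)
    case (Suc k)
    have "((g ^^ (k + s)) a, (g ^^ (Suc k + s)) a) \<in> R ^^ m" using g gA by simp
    from relpow_trans[OF Suc this] show ?case by (simp add: add.commute)
  qed simp
  obtain s t where st: "s < t" "(g ^^ s) a = (g ^^ t) a"
    using finite gA by (rule funpow_repeats)
  define c where "c = (g ^^ s) a"
  have c: "c \<in> A" "(c, c) \<in> R ^^ ((t - s) * m)"
    using gA walk[of s "t - s"] st by (simp_all add: c_def)
  moreover have "(t - s) * m \<ge> 1" using st m by simp
  \<comment> \<open>The closed walk at \<open>c\<close> excludes alternative (c) and
    \<open>noZ\<close> excludes (b), so (a) remains.\<close>
  ultimately obtain p where p: "(c, c) \<in> R ^^ p" "(c, c) \<in> R ^^ Suc p"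
    using good[of c] noZ[of c] unfolding good_def by blast
  have "(c, c) \<in> R ^^ ((m - 1) * p + Suc p)"
    using closed_walk_mult[OF p(1)] p(2) relpow_trans by metis
  also have "(m - 1) * p + Suc p = Suc (p * m)"
    using m(1) by (cases m) (simp_all add: algebra_simps)
  finally have "(a, c) \<in> R ^^ (s * m + Suc (p * m))"
    using walk[of 0 s] by (auto simp: c_def intro: relpow_trans)
  then have "(a, c) \<in> R ^^ Suc ((s + p) * m)" by (simp add: algebra_simps)
  then have "(f ^^ Suc ((s + p) * m)) u $ a = 0"
    unfolding funpow_eq_0_iff using c(1) unfolding A_def by blast
  then show ?thesis using per by simp
qed

lemma periodic_fixed_if_good:
  assumes good: "\<And>a. good a" and m: "m \<ge> 1" "(f ^^ m) u = u"
  shows "f u = u"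
proof (rule ccontr)
  assume "f u \<noteq> u"
  then obtain a where neq: "f u $ a \<noteq> u $ a" by (auto simp: vec_eq_iff)
  have per: "(f ^^ m) ((f ^^ k) u) = (f ^^ k) u" for k
    using m(2) by (metis add.commute comp_apply funpow_add)
  have down: "(f ^^ Suc k) u $ a = 0" if "(f ^^ k) u $ a = 0" for k
    using periodic_decreasing[OF good m(1) per that] by simp
  have fa: "f u $ a = 0" "u $ a = 1"
    using down[of 0] neq by (cases "u $ a"; cases "f u $ a"; simp)+
  \<comment> \<open>A coordinate once 0 stays 0 along the orbit, yet at time \<open>m\<close> it
    must again equal \<open>u $ a = 1\<close>.\<close>
  have "(f ^^ Suc k) u $ a = 0" for k
  proof (induction k)
    case (Suc k)
    then show ?case by (rule down)
  qed (use fa in simp)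
  from this[of "m - 1"] m fa show False by simp
qed

lemma fixed_point_system_iff_good: "fixed_point_system f \<longleftrightarrow> (\<forall>a. good a)"
  unfolding fixed_point_system_iff using good_if_periodic_fixed periodic_fixed_if_good by blast

end

section \<open>Back to monomials and the dependency graph\<close>

lemma bit_prod_eq_1_iff:
  fixes g :: "'a \<Rightarrow> bit"
  assumes "finite A"
  shows "prod g A = 1 \<longleftrightarrow> (\<forall>a\<in>A. g a = 1)"
  using assms by (induction A) auto

text \<open>\<open>Epsilon\<close> has no outgoing arc, so a walk from a variable that ends
  elsewhere never meets it.\<close>

lemma relpow_dependency_graph:
  "(Vertex i, v) \<in> parcs (dependency_graph \<alpha> \<epsilon>) ^^ k \<and> v \<noteq> Epsilon \<longleftrightarrow>
     (\<exists>j. v = Vertex j \<and> (i, j) \<in> {(i, j). \<alpha> i = 1 \<and> \<epsilon> j i = 1} ^^ k)"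
proof (induction k arbitrary: v)
  case 0
  show ?case by auto
next
  case (Suc k)
  have "(Vertex i, v) \<in> parcs (dependency_graph \<alpha> \<epsilon>) ^^ Suc k \<and> v \<noteq> Epsilon \<longleftrightarrow>
      (\<exists>w. ((Vertex i, w) \<in> parcs (dependency_graph \<alpha> \<epsilon>) ^^ k \<and> w \<noteq> Epsilon) \<and>
        (w, v) \<in> parcs (dependency_graph \<alpha> \<epsilon>) \<and> v \<noteq> Epsilon)"
    by (auto simp: dependency_graph_def)
  also have "\<dots> \<longleftrightarrow> (\<exists>j. v = Vertex j \<and> (i, j) \<in> {(i, j). \<alpha> i = 1 \<and> \<epsilon> j i = 1} ^^ Suc k)"
    unfolding Suc.IH by (auto simp: dependency_graph_def relcomp_unfold)
  finally show ?case .
qed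

theorem theorem6p1:
  fixes f :: "bit ^ 'n \<Rightarrow> bit ^ 'n"
    and \<alpha> :: "'n::finite \<Rightarrow> bit"
    and \<epsilon> :: "'n \<Rightarrow> 'n \<Rightarrow> nat"
    and X :: "'n dep_vertex pair_pre_digraph"
  assumes "boolean_monomial_system \<alpha> \<epsilon> f"
    and "X = dependency_graph \<alpha> \<epsilon>"
  shows "fixed_point_system f \<longleftrightarrow>
    (\<forall>a \<in> pverts X - {Epsilon}.
        (\<exists>p q. walk X a p a \<and> walk X a q a \<and> length q = length p + 1)
      \<or> (\<exists>z p. is_zero X z \<and> walk X a p z)
      \<or> \<not> (\<exists>p. walk X a p a \<and> length p \<ge> 1))"
proof -
  define R where "R = {(i, j). \<alpha> i = 1 \<and> \<epsilon> j i = 1}"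
  define Z where "Z = {i. \<alpha> i = 0}"
  have \<epsilon>: "\<epsilon> j i = 0 \<or> \<epsilon> j i = 1" for i j
    using assms(1) unfolding boolean_monomial_system_def by blast
  have mono: "monomial \<alpha> \<epsilon> i x = 1 \<longleftrightarrow> i \<notin> Z \<and> (\<forall>j. (i, j) \<in> R \<longrightarrow> x $ j = 1)" for i x
  proof -
    have pow: "x $ j ^ \<epsilon> j i = 1 \<longleftrightarrow> (\<epsilon> j i = 1 \<longrightarrow> x $ j = 1)" for j
      using \<epsilon>[of j i] by auto
    have "(\<Prod>j\<in>UNIV. x $ j ^ \<epsilon> j i) = 1 \<longleftrightarrow> (\<forall>j. \<epsilon> j i = 1 \<longrightarrow> x $ j = 1)"
      unfolding bit_prod_eq_1_iff[OF finite_class.finite_UNIV] pow by blast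
    then have "monomial \<alpha> \<epsilon> i x = 1 \<longleftrightarrow> \<alpha> i = 1 \<and> (\<forall>j. \<epsilon> j i = 1 \<longrightarrow> x $ j = 1)"
      by (cases "\<alpha> i = 1") (simp_all only: monomial_def mult_zero_left mult_1_left bit_not_one_iff zero_neq_one simp_thms)
    then show ?thesis
      by (cases "\<alpha> i") (simp_all add: Z_def R_def)
  qed
  have "f x $ i = monomial \<alpha> \<epsilon> i x" for x i
    using assms(1) by (simp add: boolean_monomial_system_def)
  then interpret conjunctive_network f R Z
    by unfold_locales (simp only: mono)
  have zero: "is_zero X v \<longleftrightarrow> (\<exists>i\<in>Z. v = Vertex i)" for v
  proof -
    have "monomial \<alpha> \<epsilon> i = (\<lambda>x. 0) \<longleftrightarrow> i \<in> Z" for i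
    proof
      assume "monomial \<alpha> \<epsilon> i = (\<lambda>x. 0)"
      \<comment> \<open>At the all-ones state every monomial with \<alpha> equal to 1 takes the
        value 1.\<close>
      then show "i \<in> Z" using mono[of i "\<chi> j. 1"] by simp
    qed (auto simp: monomial_def Z_def)
    then show ?thesis by (auto simp: is_zero_def assms(2) dependency_graph_def)
  qed
  have verts: "pverts X - {Epsilon} = range Vertex"
    by (auto simp: assms(2) dependency_graph_def)
  have walks: "(\<exists>p. walk X (Vertex i) p (Vertex j) \<and> length p = k) \<longleftrightarrow> (i, j) \<in> R ^^ k" for i j k
    using relpow_dependency_graph[of i "Vertex j" k \<alpha> \<epsilon>] verts
    unfolding ex_walk_iff_relpow R_def assms(2) by auto
  have good_iff: "good i \<longleftrightarrow>
        (\<exists>p q. walk X (Vertex i) p (Vertex i) \<and> walk X (Vertex i) q (Vertex i) \<and>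
           length q = length p + 1)
      \<or> (\<exists>z p. is_zero X z \<and> walk X (Vertex i) p z)
      \<or> \<not> (\<exists>p. walk X (Vertex i) p (Vertex i) \<and> length p \<ge> 1)" for i
  proof -
    have "(\<exists>p q. walk X (Vertex i) p (Vertex i) \<and> walk X (Vertex i) q (Vertex i) \<and>
        length q = length p + 1) \<longleftrightarrow> (\<exists>k. (i, i) \<in> R ^^ k \<and> (i, i) \<in> R ^^ Suc k)"
      unfolding walks[symmetric] by (metis Suc_eq_plus1)
    moreover have "(\<exists>z p. is_zero X z \<and> walk X (Vertex i) p z) \<longleftrightarrow> (\<exists>k. \<exists>z\<in>Z. (i, z) \<in> R ^^ k)"
      unfolding walks[symmetric] zero by blast
    moreover have "(\<exists>p. walk X (Vertex i) p (Vertex i) \<and> length p \<ge> 1) \<longleftrightarrow> (\<exists>k\<ge>1. (i, i) \<in> R ^^ k)"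
      unfolding walks[symmetric] by blast
    ultimately show ?thesis unfolding good_def by blast
  qed
  show ?thesis
    by (simp only: fixed_point_system_iff_good verts ball_simps ball_UNIV good_iff[symmetric])
qed

end
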